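(* Any Maass form $F_M$ for $\Gamma_1=\mathrm{SL}(2,\mathbb{Z})$ is invariant, up to a multiplicative constant, under the $T\overline T$ semigroup $\mathfrak T$: for every $\alpha\ge 0$, the deformed function $F_M^\alpha$ equals a constant (independent of $\delta$, possibly depending on $\alpha$ and on $F_M$) times $F_M$.
   Context: Let $\mathbb{H}=\{\delta=\delta_1+i\delta_2:\delta_1>0\}$ be the right half plane (with $\tau=i\delta$ in the upper half plane), on which $\Gamma_1=\mathrm{SL}(2,\mathbb{Z})$ acts, generated by $S:\delta\to1/\delta$ and $T:\delta\to\delta-i$. A Maass form for $\Gamma_1$ is a smooth function $F_M$ on $\mathbb{H}$ such that: (i) $F_M(\gamma(\delta))=F_M(\delta)$ for all $\gamma\in\Gamma_1$; (ii) $F_M$ is an eigenfunction of the invariant Laplacian $\Delta_{\mathbb H}=-\delta_1^2(\partial_{\delta_1}^2+\partial_{\delta_2}^2)$; (iii) $F_M(\delta_1+i\delta_2)$ is polynomially bounded as $\delta_1\to\infty$. The $T\overline T$ semigroup $\mathfrak T$, isomorphic to the additive semigroup of $\alpha\in[0,\infty)$, acts on functions $F$ of the modulus $\delta$ by $F\mapsto F^\alpha$, where the $T\overline T$ flow is generated by $$\partial_\alpha F^\alpha=-\tfrac14\,\Delta_{\mathbb H}F^\alpha,\qquad F^0=F.$$ *)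

theory Defs
  imports "HOL-Analysis.Analysis"
begin

text \<open>Functions on the right half plane are total functions on \<^typ>\<open>complex\<close>; only their
  values on the half plane matter.\<close>

definition right_half_plane :: "complex set" where
  "right_half_plane = {\<delta>. Re \<delta> > 0}"

text \<open>\<open>C\<^sup>k\<close> regularity in the real sense on an open set, all directional derivatives
  of order at most \<open>k\<close> being continuous.\<close>

fun Ck_on :: "nat \<Rightarrow> complex set \<Rightarrow> (complex \<Rightarrow> complex) \<Rightarrow> bool" where
  "Ck_on 0 U f \<longleftrightarrow> continuous_on U f"
| "Ck_on (Suc k) U f \<longleftrightarrow>
     (\<forall>x\<in>U. f differentiable (at x)) \<and>
     (\<forall>v. Ck_on k U (\<lambda>x. frechet_derivative f (at x) v))"

definition smooth_fun_on :: "complex set \<Rightarrow> (complex \<Rightarrow> complex) \<Rightarrow> bool" where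
  "smooth_fun_on U f \<longleftrightarrow> (\<forall>k. Ck_on k U f)"

definition partial1 :: "(complex \<Rightarrow> complex) \<Rightarrow> complex \<Rightarrow> complex" where
  "partial1 f \<delta> = frechet_derivative f (at \<delta>) 1"

definition partial2 :: "(complex \<Rightarrow> complex) \<Rightarrow> complex \<Rightarrow> complex" where
  "partial2 f \<delta> = frechet_derivative f (at \<delta>) \<i>"

definition hyp_laplacian :: "(complex \<Rightarrow> complex) \<Rightarrow> complex \<Rightarrow> complex" where
  "hyp_laplacian f \<delta> =
     - (complex_of_real ((Re \<delta>)\<^sup>2) * (partial1 (partial1 f) \<delta> + partial2 (partial2 f) \<delta>))"

text \<open>The Moebius action \<open>\<tau> \<mapsto> (a \<tau> + b) / (c \<tau> + d)\<close> transported along \<open>\<tau> = \<i> \<delta>\<close>;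
  \<open>(a, b, c, d) = (0, -1, 1, 0)\<close> gives \<open>\<delta> \<mapsto> 1 / \<delta>\<close> and \<open>(1, 1, 0, 1)\<close> gives
  \<open>\<delta> \<mapsto> \<delta> - \<i>\<close>.\<close>

definition modular_act :: "int \<Rightarrow> int \<Rightarrow> int \<Rightarrow> int \<Rightarrow> complex \<Rightarrow> complex" where
  "modular_act a b c d \<delta> =
     - \<i> * ((of_int a * (\<i> * \<delta>) + of_int b) / (of_int c * (\<i> * \<delta>) + of_int d))"

definition modular_invariant :: "(complex \<Rightarrow> complex) \<Rightarrow> bool" where
  "modular_invariant F \<longleftrightarrow>
     (\<forall>a b c d. a * d - b * c = 1 \<longrightarrow>
        (\<forall>\<delta>\<in>right_half_plane. F (modular_act a b c d \<delta>) = F \<delta>))"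

definition poly_bounded_at_cusp :: "(complex \<Rightarrow> complex) \<Rightarrow> bool" where
  "poly_bounded_at_cusp F \<longleftrightarrow>
     (\<exists>C Y. \<exists>N::nat. \<forall>\<delta>\<in>right_half_plane. Re \<delta> \<ge> Y \<longrightarrow> norm (F \<delta>) \<le> C * Re \<delta> ^ N)"

definition maass_form :: "(complex \<Rightarrow> complex) \<Rightarrow> bool" where
  "maass_form F \<longleftrightarrow>
     smooth_fun_on right_half_plane F \<and>
     modular_invariant F \<and>
     (\<exists>l::complex. \<forall>\<delta>\<in>right_half_plane. hyp_laplacian F \<delta> = l * F \<delta>) \<and>
     poly_bounded_at_cusp F"

definition hyp_dist :: "complex \<Rightarrow> complex \<Rightarrow> real" where
  "hyp_dist z w = arcosh (1 + (norm (z - w))\<^sup>2 / (2 * Re z * Re w))"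

text \<open>\<open>F\<^sup>\<alpha>\<close> is the solution of a heat equation on the hyperbolic plane, so the initial value
  problem determines it only within a class of bounded growth. We use classical solutions in the
  Tychonoff class, of growth at most \<open>exp (a dist\<^sup>2)\<close> locally uniformly in \<open>\<alpha>\<close>; this does
  not presuppose modular invariance of the deformed function.\<close>

definition hyp_tychonoff_class :: "(real \<Rightarrow> complex \<Rightarrow> complex) \<Rightarrow> bool" where
  "hyp_tychonoff_class G \<longleftrightarrow>
     (\<forall>A\<ge>0. \<exists>C a. \<forall>\<alpha>\<in>{0..A}. \<forall>\<delta>\<in>right_half_plane.
        norm (G \<alpha> \<delta>) \<le> C * exp (a * (hyp_dist \<delta> 1)\<^sup>2))"

definition TTbar_flow :: "(complex \<Rightarrow> complex) \<Rightarrow> (real \<Rightarrow> complex \<Rightarrow> complex) \<Rightarrow> bool" where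
  "TTbar_flow F G \<longleftrightarrow>
     (\<forall>\<delta>\<in>right_half_plane. G 0 \<delta> = F \<delta>) \<and>
     continuous_on ({0..} \<times> right_half_plane) (\<lambda>(\<alpha>, \<delta>). G \<alpha> \<delta>) \<and>
     (\<forall>\<alpha>>0. Ck_on 2 right_half_plane (G \<alpha>)) \<and>
     (\<forall>\<alpha>>0. \<forall>\<delta>\<in>right_half_plane.
        ((\<lambda>s. G s \<delta>) has_vector_derivative (- (1 / 4) * hyp_laplacian (G \<alpha>) \<delta>)) (at \<alpha>)) \<and>
     hyp_tychonoff_class G"

end

theory Submission
  imports Defs
begin

text \<open>If \<open>F\<close> has Laplace eigenvalue \<open>l\<close>, then \<open>exp (- l \<alpha> / 4) F\<close> solves the flow equation, so the
  theorem is an existence and uniqueness statement in the Tychonoff class. For existence, reducing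
  \<open>\<delta>\<close> to the fundamental domain changes the real part to at most \<open>Re \<delta> + 1 / Re \<delta>\<close>, which is
  at most \<open>2 cosh (dist \<delta> 1)\<close>; hence polynomial growth at the cusp gives growth at most
  \<open>exp (N dist)\<close> everywhere. For uniqueness, the difference of two solutions is compared by the
  maximum principle with the barrier \<open>exp (h(t) L\<^sup>2)\<close>, where \<open>L = 1 + ln cosh dist\<close> is
  a smooth substitute for the distance with \<open>|\<nabla>L| \<le> 1\<close> and \<open>\<Delta>L \<le> 2\<close>. The function
  \<open>h\<close> blows up in finite time, so the comparison is iterated over short time steps.\<close>

section \<open>Real calculus and \<open>Ck_on\<close> regularity\<close>

text \<open>\<open>f'\<close> vanishes at the maximum. If \<open>D\<close> were positive,
  \<open>f'\<close> would be positive just to the right of 0, and the mean value theorem would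
  produce a value above \<open>f 0\<close>. No second derivative is required away from 0.\<close>

lemma second_derivative_nonpos_at_max:
  fixes f f' :: "real \<Rightarrow> real"
  assumes d: "d > 0"
    and f: "\<And>s. \<bar>s\<bar> < d \<Longrightarrow> (f has_real_derivative f' s) (at s)"
    and f': "(f' has_real_derivative D) (at 0)"
    and max: "\<And>s. \<bar>s\<bar> < d \<Longrightarrow> f s \<le> f 0"
  shows "D \<le> 0"
proof (rule ccontr)
  assume "\<not> D \<le> 0"
  then have "D > 0" by simp
  have f'0: "f' 0 = 0"
    using DERIV_local_max[OF f[of 0] d] max d by (simp add: abs_minus_commute)
  obtain e where e: "e > 0" "\<And>h. h > 0 \<Longrightarrow> h < e \<Longrightarrow> f' 0 < f' (0 + h)"
    using DERIV_pos_inc_right[OF f' \<open>D > 0\<close>] by blast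
  define r where "r = min d e / 2"
  have r: "r > 0" "r < d" "r < e" using d e(1) by (auto simp: r_def)
  have "\<exists>z>0. z < r \<and> f r - f 0 = (r - 0) * f' z"
    by (rule MVT2) (use r f in auto)
  then obtain z where "z > 0" "z < r" "f r - f 0 = r * f' z" by auto
  moreover have "f' z > 0" using e(2)[of z] f'0 r calculation by simp
  ultimately have "f r > f 0" using r by (smt (verit) mult_pos_pos)
  then show False using max[of r] r by simp
qed

lemma has_vector_derivative_along_line:
  fixes f :: "complex \<Rightarrow> complex"
  assumes "f differentiable (at z)"
  shows "((\<lambda>s. f (z + of_real s * v)) has_vector_derivative frechet_derivative f (at z) v) (at 0)"
proof -
  have "((\<lambda>s::real. z + of_real s * v) has_vector_derivative v) (at 0)"
    by (auto intro!: derivative_eq_intros)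
  then have "((f \<circ> (\<lambda>s. z + of_real s * v)) has_vector_derivative frechet_derivative f (at z) v) (at 0)"
    by (rule vector_derivative_diff_chain_within)
       (use assms frechet_derivative_works[of f "at z"] has_derivative_at_withinI in auto)
  then show ?thesis by (simp add: o_def)
qed

lemma open_right_half_plane: "open right_half_plane"
  unfolding right_half_plane_def by (rule open_halfspace_Re_gt)

lemma frechet_derivative_cong_open:
  assumes "open U" "x \<in> U" "\<And>y. y \<in> U \<Longrightarrow> f y = g y"
  shows "frechet_derivative f (at x) = frechet_derivative g (at x)"
proof -
  have "(f has_derivative D) (at x) \<longleftrightarrow> (g has_derivative D) (at x)" for D
    using has_derivative_transform_within_open[OF _ assms(1,2), of _ D UNIV] assms(3) by metis
  then show ?thesis by (simp add: frechet_derivative_def)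
qed

lemma frechet_derivative_cmult:
  fixes f :: "complex \<Rightarrow> complex"
  assumes "f differentiable (at x)"
  shows "frechet_derivative (\<lambda>y. c * f y) (at x) = (\<lambda>v. c * frechet_derivative f (at x) v)"
  by (rule frechet_derivative_at[symmetric])
     (use assms in \<open>auto intro!: derivative_eq_intros simp: frechet_derivative_works\<close>)

text \<open>Differentiability and the derivative at a point of an open set depend only on nearby
  values. Both functions vary in the induction because it passes to their derivatives.\<close>

lemma Ck_on_cong:
  assumes "open U" "\<And>x. x \<in> U \<Longrightarrow> f x = g x" "Ck_on k U f"
  shows "Ck_on k U g"
  using assms(2,3)
proof (induction k arbitrary: f g)
  case 0
  then show ?case by (simp cong: continuous_on_cong)
next
  case (Suc k)
  have "g differentiable (at x)" if "x \<in> U" for x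
    using Suc.prems that assms(1) unfolding differentiable_def Ck_on.simps
    by (metis has_derivative_transform_within_open)
  moreover have "Ck_on k U (\<lambda>x. frechet_derivative g (at x) v)" for v
  proof (rule Suc.IH)
    show "Ck_on k U (\<lambda>x. frechet_derivative f (at x) v)" using Suc.prems by simp
    show "frechet_derivative f (at x) v = frechet_derivative g (at x) v" if "x \<in> U" for x
      using frechet_derivative_cong_open[OF assms(1) that, of f g] Suc.prems by simp
  qed
  ultimately show ?case by simp
qed

lemma Ck_on_cmult:
  assumes "open U" "Ck_on k U f"
  shows "Ck_on k U (\<lambda>x. c * f x)"
  using assms(2)
proof (induction k arbitrary: f)
  case 0
  then show ?case by (auto intro: continuous_intros)
next
  case (Suc k)
  have "Ck_on k U (\<lambda>x. frechet_derivative (\<lambda>y. c * f y) (at x) v)" for v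
    by (rule Ck_on_cong[OF assms(1) _ Suc.IH[of "\<lambda>x. frechet_derivative f (at x) v"]])
       (use Suc.prems in \<open>auto simp: frechet_derivative_cmult\<close>)
  then show ?case using Suc.prems by (auto intro: differentiable_mult)
qed

lemma Ck_on_2D:
  assumes "Ck_on 2 U f" "x \<in> U"
  shows "f differentiable (at x)" "partial1 f differentiable (at x)" "partial2 f differentiable (at x)"
  using assms
  by (auto simp: numeral_2_eq_2 partial1_def[abs_def] partial2_def[abs_def])

text \<open>The regularity hypothesis matters because \<open>frechet_derivative\<close> is an
  unspecified choice at points of non-differentiability, where scaling may fail.\<close>

lemma hyp_laplacian_cmult:
  assumes "Ck_on 2 right_half_plane f" "x \<in> right_half_plane"
  shows "hyp_laplacian (\<lambda>y. c * f y) x = c * hyp_laplacian f x"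
proof -
  note * = Ck_on_2D[OF assms(1)]
  have "partial1 (partial1 (\<lambda>y. c * f y)) x = partial1 (\<lambda>y. c * partial1 f y) x"
    unfolding partial1_def[of _ x]
    by (subst frechet_derivative_cong_open[OF open_right_half_plane assms(2)])
       (auto simp: partial1_def frechet_derivative_cmult *)
  moreover have "partial2 (partial2 (\<lambda>y. c * f y)) x = partial2 (\<lambda>y. c * partial2 f y) x"
    unfolding partial2_def[of _ x]
    by (subst frechet_derivative_cong_open[OF open_right_half_plane assms(2)])
       (auto simp: partial2_def frechet_derivative_cmult *)
  moreover have "partial1 (\<lambda>y. c * partial1 f y) x = c * partial1 (partial1 f) x"
    using frechet_derivative_cmult[OF *(2)[OF assms(2)], of c] by (simp add: partial1_def[of _ x])
  moreover have "partial2 (\<lambda>y. c * partial2 f y) x = c * partial2 (partial2 f) x"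
    using frechet_derivative_cmult[OF *(3)[OF assms(2)], of c] by (simp add: partial2_def[of _ x])
  ultimately show ?thesis by (simp add: hyp_laplacian_def algebra_simps)
qed

section \<open>Hyperbolic distance to the point 1\<close>

text \<open>On the half plane this is the hyperbolic cosine of the distance to 1. Unlike the
  distance itself it is smooth at 1, and it is rational in the coordinates.\<close>

definition cosh_dist :: "complex \<Rightarrow> real" where
  "cosh_dist z = ((Re z)\<^sup>2 + (Im z)\<^sup>2 + 1) / (2 * Re z)"

lemma hyp_dist_one: "Re z > 0 \<Longrightarrow> hyp_dist z 1 = arcosh (cosh_dist z)"
  unfolding hyp_dist_def cosh_dist_def cmod_power2
  by (intro arg_cong[where f = arcosh]) (simp add: field_simps power2_eq_square)

lemma cosh_dist_ge_1: "Re z > 0 \<Longrightarrow> cosh_dist z \<ge> 1"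
proof -
  assume "Re z > 0"
  moreover have "(Re z - 1)\<^sup>2 + (Im z)\<^sup>2 \<ge> 0" by simp
  ultimately show ?thesis by (simp add: cosh_dist_def field_simps power2_eq_square)
qed

text \<open>\<open>arcosh p = ln (p + sqrt (p^2 - 1))\<close> is at most \<open>ln (2 * p)\<close>,
  and \<open>ln 2 < 1\<close>. This converts Tychonoff growth in the distance into growth in its
  smooth substitute.\<close>

lemma hyp_dist_one_le:
  assumes "Re z > 0"
  shows "0 \<le> hyp_dist z 1" "hyp_dist z 1 \<le> 1 + ln (cosh_dist z)"
proof -
  define p where "p = cosh_dist z"
  have p: "p \<ge> 1" using cosh_dist_ge_1[OF assms] by (simp add: p_def)
  have d: "hyp_dist z 1 = ln (p + sqrt (p\<^sup>2 - 1))"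
    using assms p by (simp add: hyp_dist_one p_def[symmetric] arcosh_real_def)
  have s: "0 \<le> sqrt (p\<^sup>2 - 1)" using p by simp
  show "0 \<le> hyp_dist z 1" unfolding d using p s by (intro ln_ge_zero) linarith
  have "sqrt (p\<^sup>2 - 1) \<le> p" using p by (intro real_le_lsqrt) auto
  moreover have "p + sqrt (p\<^sup>2 - 1) > 0" using p s by linarith
  ultimately have "ln (p + sqrt (p\<^sup>2 - 1)) \<le> ln (2 * p)" using p by (subst ln_le_cancel_iff) auto
  also have "\<dots> = ln 2 + ln p" using p by (simp add: ln_mult)
  also have "\<dots> \<le> 1 + ln p" using ln_2_less_1 by simp
  finally show "hyp_dist z 1 \<le> 1 + ln (cosh_dist z)" by (simp add: d p_def)
qed

text \<open>A hyperbolic ball about 1 is a Euclidean disc with real centre \<open>P\<close> and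
  radius \<open>sqrt (P^2 - 1) < P\<close>, so it stays away from the boundary. For
  \<open>P < 1\<close> the set is empty.\<close>

lemma compact_cosh_dist_le:
  fixes P :: real
  defines "K \<equiv> {z. Re z > 0 \<and> cosh_dist z \<le> P}"
  shows "compact K" "K \<subseteq> right_half_plane"
proof -
  show "K \<subseteq> right_half_plane" by (auto simp: K_def right_half_plane_def)
  have eq: "cosh_dist z \<le> P \<longleftrightarrow> (Re z - P)\<^sup>2 + (Im z)\<^sup>2 \<le> P\<^sup>2 - 1" if "Re z > 0" for z
    using that by (simp add: cosh_dist_def field_simps power2_eq_square)
  show "compact K"
  proof (cases "P \<ge> 1")
    case True
    have "K = cball (of_real P) (sqrt (P\<^sup>2 - 1))"
    proof (intro set_eqI iffI)
      fix z assume "z \<in> K"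
      then have "(Re z - P)\<^sup>2 + (Im z)\<^sup>2 \<le> P\<^sup>2 - 1" using eq by (auto simp: K_def)
      then show "z \<in> cball (of_real P) (sqrt (P\<^sup>2 - 1))"
        by (simp add: dist_norm cmod_def power2_commute)
    next
      fix z assume "z \<in> cball (complex_of_real P) (sqrt (P\<^sup>2 - 1))"
      then have *: "(Re z - P)\<^sup>2 + (Im z)\<^sup>2 \<le> P\<^sup>2 - 1"
        by (simp add: dist_norm cmod_def power2_commute)
      have "(Re z - P)\<^sup>2 \<le> (Re z - P)\<^sup>2 + (Im z)\<^sup>2" by simp
      with * have "(Re z - P)\<^sup>2 < P\<^sup>2" by linarith
      then have "\<bar>Re z - P\<bar> < \<bar>P\<bar>" by (simp add: abs_le_square_iff linorder_not_le[symmetric])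
      then have "Re z > 0" using True by linarith
      then show "z \<in> K" using * eq by (simp add: K_def)
    qed
    then show ?thesis by simp
  next
    case False
    then have "K = {}" using cosh_dist_ge_1 by (fastforce simp: K_def)
    then show ?thesis by simp
  qed
qed

text \<open>Here \<open>p\<close> stands for \<open>cosh_dist\<close> along a coordinate line and
  \<open>q\<close>, \<open>r\<close> for its first two derivatives. The results are the first two
  derivatives of the barrier along that line.\<close>

lemma barrier_derivatives:
  fixes p q :: "real \<Rightarrow> real"
  assumes "(p has_real_derivative q s) (at s)" "p s > 0"
  shows "((\<lambda>s. exp (h * (1 + ln (p s))\<^sup>2)) has_real_derivative
           exp (h * (1 + ln (p s))\<^sup>2) * (2 * h * (1 + ln (p s)) * q s / p s)) (at s)"
    and "(q has_real_derivative r) (at s) \<Longrightarrow>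
         ((\<lambda>s. exp (h * (1 + ln (p s))\<^sup>2) * (2 * h * (1 + ln (p s)) * q s / p s)) has_real_derivative
           exp (h * (1 + ln (p s))\<^sup>2) * (4 * h\<^sup>2 * (1 + ln (p s))\<^sup>2 * (q s)\<^sup>2 / (p s)\<^sup>2
             + 2 * h * (q s)\<^sup>2 / (p s)\<^sup>2 + 2 * h * (1 + ln (p s)) * (r / p s - (q s)\<^sup>2 / (p s)\<^sup>2))) (at s)"
  using assms
   by (auto intro!: derivative_eq_intros simp: field_simps power2_eq_square)

lemma cosh_dist_derivatives:
  assumes "Re z + s > 0"
  shows "((\<lambda>s. cosh_dist (z + of_real s)) has_real_derivative
            ((Re z + s)\<^sup>2 - (Im z)\<^sup>2 - 1) / (2 * (Re z + s)\<^sup>2)) (at s)"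
    and "((\<lambda>s. ((Re z + s)\<^sup>2 - (Im z)\<^sup>2 - 1) / (2 * (Re z + s)\<^sup>2)) has_real_derivative
            ((Im z)\<^sup>2 + 1) / (Re z + s) ^ 3) (at s)"
proof -
  define X where "X = Re z + s"
  have X: "X > 0" "Re z = X - s" using assms by (simp_all add: X_def)
  show "((\<lambda>s. cosh_dist (z + of_real s)) has_real_derivative
            ((Re z + s)\<^sup>2 - (Im z)\<^sup>2 - 1) / (2 * (Re z + s)\<^sup>2)) (at s)"
    unfolding cosh_dist_def using X
    by (auto intro!: derivative_eq_intros simp: X(2))
       (simp add: field_simps power2_eq_square)
  show "((\<lambda>s. ((Re z + s)\<^sup>2 - (Im z)\<^sup>2 - 1) / (2 * (Re z + s)\<^sup>2)) has_real_derivative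
            ((Im z)\<^sup>2 + 1) / (Re z + s) ^ 3) (at s)"
    using X by (auto intro!: derivative_eq_intros simp: X(2))
       (simp add: field_simps power2_eq_square power3_eq_cube power4_eq_xxxx)
qed

lemma cosh_dist_derivatives_imag:
  assumes "Re z > 0"
  shows "((\<lambda>s. cosh_dist (z + of_real s * \<i>)) has_real_derivative (Im z + s) / Re z) (at s)"
    and "((\<lambda>s. (Im z + s) / Re z) has_real_derivative 1 / Re z) (at s)"
  using assms unfolding cosh_dist_def
  by (auto intro!: derivative_eq_intros simp: field_simps power2_eq_square)

section \<open>Maximum principle for the hyperbolic heat equation\<close>

text \<open>Space derivatives enter only as one-variable derivatives along the two axes, which is
  all that the second derivative test sees. The growth bound is one-sided because only upper
  estimates of \<open>u\<close> are sought.\<close>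

locale heat_solution =
  fixes u u1 u2 u11 u22 :: "real \<Rightarrow> complex \<Rightarrow> real" and A a C :: real
  assumes cont: "continuous_on ({0..A} \<times> right_half_plane) (\<lambda>(t, z). u t z)"
    and dt: "\<And>t z. t \<in> {0<..A} \<Longrightarrow> z \<in> right_half_plane \<Longrightarrow>
      ((\<lambda>r. u r z) has_real_derivative (Re z)\<^sup>2 / 4 * (u11 t z + u22 t z)) (at t)"
    and d1: "\<And>t z. t \<in> {0<..A} \<Longrightarrow> z \<in> right_half_plane \<Longrightarrow>
      ((\<lambda>r. u t (z + of_real r)) has_real_derivative u1 t z) (at 0)"
    and d11: "\<And>t z. t \<in> {0<..A} \<Longrightarrow> z \<in> right_half_plane \<Longrightarrow>
      ((\<lambda>r. u1 t (z + of_real r)) has_real_derivative u11 t z) (at 0)"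
    and d2: "\<And>t z. t \<in> {0<..A} \<Longrightarrow> z \<in> right_half_plane \<Longrightarrow>
      ((\<lambda>r. u t (z + of_real r * \<i>)) has_real_derivative u2 t z) (at 0)"
    and d22: "\<And>t z. t \<in> {0<..A} \<Longrightarrow> z \<in> right_half_plane \<Longrightarrow>
      ((\<lambda>r. u2 t (z + of_real r * \<i>)) has_real_derivative u22 t z) (at 0)"
    and bound: "\<And>t z. t \<in> {0..A} \<Longrightarrow> z \<in> right_half_plane \<Longrightarrow>
      u t z \<le> C * exp (a * (1 + ln (cosh_dist z))\<^sup>2)"
    and a: "a \<ge> 0"
begin

text \<open>For each \<epsilon> > 0 the barrier \<epsilon> \<open>W\<close> beats the growth bound
  outside a compact set, so a positive value of \<open>u\<close> - \<epsilon> \<open>W\<close>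
  forces a positive maximum. There the heat equation contradicts strictness of the supersolution;
  then \<epsilon> tends to 0. The bound on \<open>T - s\<close> keeps the denominator of
  \<open>h\<close> at least 1/2.\<close>

lemma max_principle_short_time:
  assumes sT: "0 \<le> s" "T \<le> A" and T: "6 * (a + 1) * (T - s) \<le> 1"
    and init: "\<And>z. z \<in> right_half_plane \<Longrightarrow> u s z \<le> 0"
    and t: "t \<in> {s..T}" and z: "z \<in> right_half_plane"
  shows "u t z \<le> 0"
proof -
  define H where "H = right_half_plane"
  note z = z[folded H_def] and init = init[folded H_def]
  define b where "b = a + 1"
  have b: "b \<ge> 1" using a by (simp add: b_def)
  \<comment> \<open>\<open>h\<close> solves \<open>h' = 3 h\<^sup>2\<close>, \<open>h(s) = b\<close>; the factor 3 exceeds the 5/2 needed for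
    \<open>exp (h L\<^sup>2)\<close> to be a supersolution, which makes it a strict one.\<close>
  define h where "h r = b / (1 - 3 * b * (r - s))" for r
  have den: "1 - 3 * b * (r - s) \<ge> 1 / 2" "1 - 3 * b * (r - s) \<le> 1" if "r \<in> {s..T}" for r
  proof -
    have "b * (r - s) \<le> b * (T - s)" using that b by (intro mult_left_mono) auto
    then show "1 - 3 * b * (r - s) \<ge> 1 / 2" using T unfolding b_def[symmetric] mult.assoc by linarith
    show "1 - 3 * b * (r - s) \<le> 1" using that b by simp
  qed
  have hb: "h r \<ge> b" if "r \<in> {s..T}" for r
    using den[OF that] b by (simp add: h_def field_simps)
  have dh: "(h has_real_derivative 3 * (h r)\<^sup>2) (at r)" if "r \<in> {s..T}" for r
    unfolding h_def using den[OF that]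
    by (auto intro!: derivative_eq_intros simp: field_simps power2_eq_square)
  define L where "L w = 1 + ln (cosh_dist w)" for w
  have L: "L w \<ge> 1" if "w \<in> H" for w
    using cosh_dist_ge_1[of w] that by (simp add: L_def H_def right_half_plane_def)
  define W where "W r w = exp (h r * (L w)\<^sup>2)" for r w
  have contL: "continuous_on H L"
    unfolding L_def cosh_dist_def H_def right_half_plane_def
    by (auto intro!: continuous_intros simp: add_pos_nonneg add_nonneg_pos)
       (metis add.commute add_nonneg_eq_0_iff add_nonneg_nonneg zero_le_one zero_le_power2 zero_neq_one)
  have contW: "continuous_on ({s..T} \<times> H) (\<lambda>(r, w). W r w)"
  proof -
    have "continuous_on {s..T} h"
      using dh by (meson DERIV_isCont continuous_at_imp_continuous_on)
    then have "continuous_on ({s..T} \<times> H) (\<lambda>x. h (fst x))"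
      by (rule continuous_on_compose2) (auto intro: continuous_intros)
    moreover have "continuous_on ({s..T} \<times> H) (\<lambda>x. L (snd x))"
      by (rule continuous_on_compose2[OF contL]) (auto intro: continuous_intros)
    ultimately show ?thesis unfolding W_def case_prod_beta
      by (intro continuous_intros)
  qed
  have main: "u t z \<le> \<epsilon> * W t z" if \<epsilon>: "\<epsilon> > 0" for \<epsilon>
  proof (rule ccontr)
    assume "\<not> u t z \<le> \<epsilon> * W t z"
    then have pos: "u t z - \<epsilon> * W t z > 0" by simp
    define v where "v r w = u r w - \<epsilon> * W r w" for r w
    \<comment> \<open>Since \<open>b = a + 1\<close>, the barrier has a spare factor
      \<open>exp (L^2)\<close> over the growth bound. It exceeds \<open>L\<close>, so it absorbs the
      constant once \<open>L\<close> is at least \<bar>\<open>C\<close>\<bar> / \<epsilon>, which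
      holds outside this ball.\<close>
    define K where "K = {w. Re w > 0 \<and> cosh_dist w \<le> exp (\<bar>C\<bar> / \<epsilon>)}"
    note K = compact_cosh_dist_le[of "exp (\<bar>C\<bar> / \<epsilon>)", folded K_def, folded H_def]
    have out: "v r w \<le> 0" if "r \<in> {s..T}" "w \<in> H" "w \<notin> K" for r w
    proof -
      have w: "cosh_dist w > exp (\<bar>C\<bar> / \<epsilon>)" "Re w > 0"
        using that by (auto simp: K_def H_def right_half_plane_def)
      then have "ln (cosh_dist w) > \<bar>C\<bar> / \<epsilon>"
        using cosh_dist_ge_1[OF w(2)] by (subst exp_less_cancel_iff[symmetric]) (simp add: exp_ln)
      then have "\<bar>C\<bar> / \<epsilon> \<le> L w" by (simp add: L_def)
      also have "\<dots> \<le> (L w)\<^sup>2" using L[OF that(2)] by (simp add: power2_eq_square)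
      also have "\<dots> \<le> exp ((L w)\<^sup>2)" using exp_ge_add_one_self[of "(L w)\<^sup>2"] by linarith
      finally have "\<bar>C\<bar> \<le> \<epsilon> * exp ((L w)\<^sup>2)" using \<epsilon> by (simp add: field_simps)
      then have "C * exp (a * (L w)\<^sup>2) \<le> \<epsilon> * exp ((L w)\<^sup>2) * exp (a * (L w)\<^sup>2)"
        by (intro mult_right_mono) auto
      also have "\<dots> = \<epsilon> * exp (b * (L w)\<^sup>2)" by (simp add: b_def exp_add[symmetric] algebra_simps)
      also have "\<dots> \<le> \<epsilon> * W r w" unfolding W_def
        using \<epsilon> hb[OF that(1)] by (intro mult_left_mono) (auto intro: mult_right_mono)
      finally show ?thesis using bound[of r w] that sT by (simp add: v_def L_def H_def)
    qed
    have zK: "z \<in> K" using out[OF t z] pos by (force simp: v_def)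
    have cv: "continuous_on ({s..T} \<times> K) (\<lambda>(r, w). v r w)"
    proof -
      have "continuous_on ({s..T} \<times> H) (\<lambda>(r, w). u r w)"
        by (rule continuous_on_subset[OF cont]) (use sT in \<open>auto simp: H_def\<close>)
      then have "continuous_on ({s..T} \<times> H) (\<lambda>(r, w). v r w)"
        using contW unfolding v_def case_prod_beta by (intro continuous_intros)
      then show ?thesis by (rule continuous_on_subset) (use K in auto)
    qed
    have "{s..T} \<times> K \<noteq> {}" using zK t by blast
    from continuous_attains_sup[OF compact_Times[OF compact_Icc K(1)] this cv]
    obtain r w where rw: "r \<in> {s..T}" "w \<in> K"
      and max0: "\<And>r' w'. r' \<in> {s..T} \<Longrightarrow> w' \<in> K \<Longrightarrow> v r' w' \<le> v r w"
      by auto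
    have vpos: "v r w > 0" using max0[OF t zK] pos by (simp add: v_def)
    have max: "v r' w' \<le> v r w" if "r' \<in> {s..T}" "w' \<in> H" for r' w'
      using max0 out that vpos by (meson less_imp_le order_trans)
    have wH: "w \<in> H" using rw K by auto
    have "r \<noteq> s"
    proof
      assume "r = s"
      moreover have "\<epsilon> * W s w \<ge> 0" using \<epsilon> by (simp add: W_def)
      ultimately show False using vpos init[OF wH] by (simp add: v_def)
    qed
    then have r: "r \<in> {s<..T}" "r \<in> {0<..A}" using rw sT by auto
    define x where "x = Re w"
    define y where "y = Im w"
    define p where "p = cosh_dist w"
    have x: "x > 0" using wH by (simp add: x_def H_def right_half_plane_def)
    have p: "p \<ge> 1" using x cosh_dist_ge_1 by (simp add: p_def x_def)
    define k where "k = h r"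
    have k: "k \<ge> 1" using hb[OF rw(1)] b by (simp add: k_def)
    define q1 where "q1 = (x\<^sup>2 - y\<^sup>2 - 1) / (2 * x\<^sup>2)"
    define q2 where "q2 = y / x"
    \<comment> \<open>The second derivative of \<open>W r\<close> at \<open>w\<close> along a line
      on which \<open>cosh_dist\<close> has first derivative \<open>q\<close> and second derivative
      \<open>q'\<close>.\<close>
    define W2 where "W2 q q' = W r w * (4 * k\<^sup>2 * (L w)\<^sup>2 * q\<^sup>2 / p\<^sup>2
             + 2 * k * q\<^sup>2 / p\<^sup>2 + 2 * k * L w * (q' / p - q\<^sup>2 / p\<^sup>2))" for q q'
    obtain d where d: "d > 0" "ball w d \<subseteq> H"
      using open_right_half_plane wH unfolding H_def by (meson openE)

    \<comment> \<open>The maximum may sit at the final time \<open>T\<close>, so only earlier times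
      are compared: a negative time derivative would make \<open>v\<close> larger just before
      \<open>r\<close>.\<close>
    have "\<not> (Re w)\<^sup>2 / 4 * (u11 r w + u22 r w) - \<epsilon> * (W r w * (3 * k\<^sup>2 * (L w)\<^sup>2)) < 0"
    proof
      assume neg: "(Re w)\<^sup>2 / 4 * (u11 r w + u22 r w) - \<epsilon> * (W r w * (3 * k\<^sup>2 * (L w)\<^sup>2)) < 0"
      have "((\<lambda>r'. v r' w) has_real_derivative
         (Re w)\<^sup>2 / 4 * (u11 r w + u22 r w) - \<epsilon> * (W r w * (3 * k\<^sup>2 * (L w)\<^sup>2))) (at r)"
        unfolding v_def W_def
        by (auto intro!: derivative_eq_intros dt[OF r(2) wH[unfolded H_def]] dh[OF rw(1)] simp: k_def)
      from DERIV_neg_dec_left[OF this neg] obtain e where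
        e: "e > 0" "\<And>h'. h' > 0 \<Longrightarrow> h' < e \<Longrightarrow> v r w < v (r - h') w" by auto
      define h' where "h' = min e (r - s) / 2"
      have "h' > 0" "h' < e" "r - h' \<in> {s..T}" using e r by (auto simp: h'_def min_def field_simps)
      then show False using e(2)[of h'] max[OF _ wH, of "r - h'"] by force
    qed
    then have time: "\<epsilon> * (W r w * (3 * k\<^sup>2 * (L w)\<^sup>2)) \<le> x\<^sup>2 / 4 * (u11 r w + u22 r w)"
      by (simp add: x_def)

    have s1: "u11 r w - \<epsilon> * W2 q1 ((y\<^sup>2 + 1) / x ^ 3) \<le> 0"
    proof (rule second_derivative_nonpos_at_max[OF d(1)])
      let ?p = "\<lambda>s. cosh_dist (w + of_real s)"
      let ?q = "\<lambda>s. ((x + s)\<^sup>2 - y\<^sup>2 - 1) / (2 * (x + s)\<^sup>2)"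
      let ?f = "\<lambda>s. v r (w + of_real s)"
      let ?f' = "\<lambda>s. u1 r (w + of_real s) - \<epsilon> *
        (exp (k * (1 + ln (?p s))\<^sup>2) * (2 * k * (1 + ln (?p s)) * ?q s / ?p s))"
      show "(?f has_real_derivative ?f' s) (at s)" if "\<bar>s\<bar> < d" for s
      proof -
        have wsH: "w + of_real s \<in> H" using d that by (auto simp: dist_norm)
        then have xs: "Re w + s > 0" by (simp add: H_def right_half_plane_def)
        have ps: "?p s > 0" using cosh_dist_ge_1[of "w + of_real s"] xs by simp
        \<comment> \<open>The locale gives derivatives at parameter 0 only; basing the line at the
          shifted point gives them at every \<open>s\<close>.\<close>
        have "((\<lambda>s'. u r (w + of_real s')) has_real_derivative u1 r (w + of_real s)) (at s)"
          using d1[OF r(2) wsH[unfolded H_def]] DERIV_shift[of "\<lambda>s'. u r (w + of_real s')" _ 0 s]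
          by (simp add: add_ac)
        moreover have "(?p has_real_derivative ?q s) (at s)"
          using cosh_dist_derivatives(1)[OF xs] by (simp add: x_def y_def)
        ultimately show ?thesis unfolding v_def W_def L_def k_def[symmetric]
          by (intro DERIV_diff DERIV_cmult barrier_derivatives(1) ps)
      qed
      have xs: "Re w + 0 > 0" using x by (simp add: x_def)
      have "(?p has_real_derivative ?q 0) (at 0)" "(?q has_real_derivative (y\<^sup>2 + 1) / (x + 0) ^ 3) (at 0)"
        using cosh_dist_derivatives[OF xs] by (simp_all add: x_def y_def)
      from barrier_derivatives(2)[OF this(1) _ this(2), of k]
      show "(?f' has_real_derivative u11 r w - \<epsilon> * W2 q1 ((y\<^sup>2 + 1) / x ^ 3)) (at 0)"
        using p by (intro DERIV_diff DERIV_cmult d11 r(2) wH[unfolded H_def])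
          (simp add: W2_def W_def k_def[symmetric] L_def p_def q1_def)
      show "?f s \<le> ?f 0" if "\<bar>s\<bar> < d" for s
      proof -
        have "w + of_real s \<in> H" using d that by (auto simp: dist_norm)
        then show ?thesis using max[OF rw(1)] by simp
      qed
    qed

    have s2: "u22 r w - \<epsilon> * W2 q2 (1 / x) \<le> 0"
    proof (rule second_derivative_nonpos_at_max[OF d(1)])
      let ?p = "\<lambda>s. cosh_dist (w + of_real s * \<i>)"
      let ?q = "\<lambda>s. (y + s) / x"
      let ?f = "\<lambda>s. v r (w + of_real s * \<i>)"
      let ?f' = "\<lambda>s. u2 r (w + of_real s * \<i>) - \<epsilon> *
        (exp (k * (1 + ln (?p s))\<^sup>2) * (2 * k * (1 + ln (?p s)) * ?q s / ?p s))"
      show "(?f has_real_derivative ?f' s) (at s)" if "\<bar>s\<bar> < d" for s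
      proof -
        have wsH: "w + of_real s * \<i> \<in> H" using d that by (auto simp: dist_norm norm_mult)
        have xs: "Re w > 0" using x by (simp add: x_def)
        have ps: "?p s > 0" using cosh_dist_ge_1[of "w + of_real s * \<i>"] xs by simp
        have "((\<lambda>s'. u r (w + of_real s' * \<i>)) has_real_derivative u2 r (w + of_real s * \<i>)) (at s)"
          using d2[OF r(2) wsH[unfolded H_def]] DERIV_shift[of "\<lambda>s'. u r (w + of_real s' * \<i>)" _ 0 s]
          by (simp add: algebra_simps)
        moreover have "(?p has_real_derivative ?q s) (at s)"
          using cosh_dist_derivatives_imag(1)[OF xs] by (simp add: x_def y_def)
        ultimately show ?thesis unfolding v_def W_def L_def k_def[symmetric]
          by (intro DERIV_diff DERIV_cmult barrier_derivatives(1) ps)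
      qed
      have xs: "Re w > 0" using x by (simp add: x_def)
      have "(?p has_real_derivative ?q 0) (at 0)" "(?q has_real_derivative 1 / x) (at 0)"
        using cosh_dist_derivatives_imag[OF xs, of 0] by (simp_all add: x_def y_def)
      from barrier_derivatives(2)[OF this(1) _ this(2), of k]
      show "(?f' has_real_derivative u22 r w - \<epsilon> * W2 q2 (1 / x)) (at 0)"
        using p by (intro DERIV_diff DERIV_cmult d22 r(2) wH[unfolded H_def])
          (simp add: W2_def W_def k_def[symmetric] L_def p_def q2_def)
      show "?f s \<le> ?f 0" if "\<bar>s\<bar> < d" for s
      proof -
        have "w + of_real s * \<i> \<in> H" using d that by (auto simp: dist_norm norm_mult)
        then show ?thesis using max[OF rw(1)] by simp
      qed
    qed

    have "x\<^sup>2 / 4 * (u11 r w + u22 r w) \<le> x\<^sup>2 / 4 * (\<epsilon> * (W2 q1 ((y\<^sup>2 + 1) / x ^ 3) + W2 q2 (1 / x)))"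
      using s1 s2 by (intro mult_left_mono) (auto simp: algebra_simps)
    with time have "\<epsilon> * (W r w * (3 * k\<^sup>2 * (L w)\<^sup>2)) \<le>
        \<epsilon> * (x\<^sup>2 / 4 * (W2 q1 ((y\<^sup>2 + 1) / x ^ 3) + W2 q2 (1 / x)))"
      by (simp add: mult_ac)
    then have le: "W r w * (3 * k\<^sup>2 * (L w)\<^sup>2) \<le> x\<^sup>2 / 4 * (W2 q1 ((y\<^sup>2 + 1) / x ^ 3) + W2 q2 (1 / x))"
      using \<epsilon> by simp
    \<comment> \<open>With \<open>p = cosh dist\<close>, this is \<open>tanh^2 dist\<close>, the
      squared hyperbolic gradient of \<open>ln p\<close>, hence of \<open>L\<close>.\<close>
    define Q where "Q = (p\<^sup>2 - 1) / p\<^sup>2"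
    have Q: "0 \<le> Q" "Q \<le> 1" using p by (auto simp: Q_def field_simps)
    have pxy: "p = (x\<^sup>2 + y\<^sup>2 + 1) / (2 * x)" by (simp add: p_def cosh_dist_def x_def y_def)
    \<comment> \<open>For the distance function \<open>d\<close> to 1, the next two facts are
      |\<nabla> cosh d|^2 = sinh^2 d and \<Delta> cosh d = 2 cosh d, where \<Delta> is the Laplacian
      without the minus sign of \<open>hyp_laplacian\<close>.\<close>
    have grad: "x\<^sup>2 * (q1\<^sup>2 + q2\<^sup>2) = p\<^sup>2 - 1"
      unfolding q1_def q2_def pxy using x by (simp add: field_simps power2_eq_square)
    have lap: "x\<^sup>2 * ((y\<^sup>2 + 1) / x ^ 3 + 1 / x) = 2 * p"
      unfolding pxy using x by (simp add: field_simps power2_eq_square power3_eq_cube)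
    have "x\<^sup>2 * (W2 q1 ((y\<^sup>2 + 1) / x ^ 3) + W2 q2 (1 / x)) =
      W r w * (4 * k\<^sup>2 * (L w)\<^sup>2 * (x\<^sup>2 * (q1\<^sup>2 + q2\<^sup>2)) / p\<^sup>2 + 2 * k * (x\<^sup>2 * (q1\<^sup>2 + q2\<^sup>2)) / p\<^sup>2
        + 2 * k * L w * ((x\<^sup>2 * ((y\<^sup>2 + 1) / x ^ 3 + 1 / x)) / p - (x\<^sup>2 * (q1\<^sup>2 + q2\<^sup>2)) / p\<^sup>2))"
      unfolding W2_def by (simp add: add_divide_distrib diff_divide_distrib algebra_simps)
    also have "\<dots> = W r w * (4 * k\<^sup>2 * (L w)\<^sup>2 * Q + 2 * k * Q + 2 * k * L w * (2 - Q))"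
      unfolding grad lap Q_def using p by simp
    finally have eq: "x\<^sup>2 * (W2 q1 ((y\<^sup>2 + 1) / x ^ 3) + W2 q2 (1 / x)) =
      W r w * (4 * k\<^sup>2 * (L w)\<^sup>2 * Q + 2 * k * Q + 2 * k * L w * (2 - Q))" .
    have Wpos: "W r w > 0" by (simp add: W_def)
    have "W r w * (12 * k\<^sup>2 * (L w)\<^sup>2) \<le> W r w * (4 * k\<^sup>2 * (L w)\<^sup>2 * Q + 2 * k * Q + 2 * k * L w * (2 - Q))"
      using le unfolding eq[symmetric] by simp
    \<comment> \<open>As \<open>Q <= 1\<close> and both \<open>k\<close> and \<open>L w\<close> are
      at least 1, the three terms on the right are at most 4, 2 and 4 times
      \<open>k^2 * (L w)^2\<close>. Their sum 10 falls short of 12.\<close>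
    then have "12 * k\<^sup>2 * (L w)\<^sup>2 \<le> 4 * k\<^sup>2 * (L w)\<^sup>2 * Q + 2 * k * Q + 2 * k * L w * (2 - Q)"
      using Wpos by simp
    moreover have "4 * k\<^sup>2 * (L w)\<^sup>2 * Q \<le> 4 * k\<^sup>2 * (L w)\<^sup>2 * 1"
      using Q by (intro mult_left_mono) auto
    moreover have kL: "k * L w \<ge> 1 * 1" using k L[OF wH] by (intro mult_mono) auto
    then have "k * L w \<le> k\<^sup>2 * (L w)\<^sup>2"
      using mult_left_mono[OF kL, of "k * L w"] by (simp add: power2_eq_square algebra_simps)
    moreover have "2 * k * Q \<le> 2 * (k * L w)"
      using k Q mult_mono[of Q "L w" "2 * k" "2 * k"] L[OF wH] by (simp add: mult_ac)
    moreover have "2 * k * L w * (2 - Q) \<le> 2 * k * L w * 2"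
      using Q k L[OF wH] by (intro mult_left_mono) auto
    moreover have "k\<^sup>2 * (L w)\<^sup>2 > 0" using k L[OF wH] by simp
    ultimately show False by linarith
  qed
  have "u t z \<le> 0 + e" if "e > 0" for e
  proof -
    have "W t z > 0" by (simp add: W_def)
    then show ?thesis using main[of "e / W t z"] that by simp
  qed
  then show ?thesis by (rule field_le_epsilon)
qed

text \<open>The growth bound holds with one exponent \<open>a\<close> on all of
  [0, \<open>A\<close>], so each restart gets the same step length and finitely many steps
  suffice.\<close>

lemma max_principle:
  assumes init: "\<And>z. z \<in> right_half_plane \<Longrightarrow> u 0 z \<le> 0"
    and t: "t \<in> {0..A}" and z: "z \<in> right_half_plane"
  shows "u t z \<le> 0"
proof -
  define \<tau> where "\<tau> = 1 / (6 * (a + 1))"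
  have \<tau>: "\<tau> > 0" using a by (simp add: \<tau>_def)
  have step: "u t z \<le> 0" if "t \<in> {0..A}" "t \<le> real n * \<tau>" "z \<in> right_half_plane" for n t z
    using that
  proof (induction n arbitrary: t z)
    case 0
    then show ?case using init by simp
  next
    case (Suc n)
    show ?case
    proof (cases "t \<le> real n * \<tau>")
      case True
      then show ?thesis using Suc by blast
    next
      case False
      show ?thesis
      proof (rule max_principle_short_time)
        have "t - real n * \<tau> \<le> \<tau>" using Suc.prems by (simp add: algebra_simps)
        then have "6 * (a + 1) * (t - real n * \<tau>) \<le> 6 * (a + 1) * \<tau>"
          using a by (intro mult_left_mono) auto
        then show "6 * (a + 1) * (t - real n * \<tau>) \<le> 1" using a by (simp add: \<tau>_def)
        show "u (real n * \<tau>) w \<le> 0" if "w \<in> right_half_plane" for w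
          using Suc.IH[of "real n * \<tau>" w] that Suc.prems False \<tau> by simp
      qed (use Suc.prems False \<tau> in auto)
    qed
  qed
  obtain n where "t < real n * \<tau>" using reals_Archimedean3[OF \<tau>] by blast
  then show ?thesis using step[OF t _ z, of n] by simp
qed

end

section \<open>Uniqueness of the flow\<close>

lemma Re_cmult_vector_derivative:
  assumes "(f has_vector_derivative f') (at s)" "(g has_vector_derivative g') (at s)"
  shows "((\<lambda>r. Re (c * (f r - g r))) has_real_derivative Re (c * (f' - g'))) (at s)"
proof -
  have "bounded_linear (\<lambda>x. Re (c * x))"
    by (intro bounded_linear_compose[OF bounded_linear_Re] bounded_linear_mult_right)
  from bounded_linear.has_vector_derivative[OF this has_vector_derivative_diff[OF assms]]
  show ?thesis by (simp add: has_real_derivative_iff_has_vector_derivative)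
qed

lemma TTbar_flow_unique:
  assumes G: "TTbar_flow F G" and G': "TTbar_flow F G'"
    and \<alpha>: "\<alpha> \<ge> 0" and \<delta>: "\<delta> \<in> right_half_plane"
  shows "G \<alpha> \<delta> = G' \<alpha> \<delta>"
proof -
  \<comment> \<open>With this phase the one-sided bound \<open>Re (c * (G - G')) \<le> 0\<close> at \<open>(\<alpha>, \<delta>)\<close> already forces
    equality there.\<close>
  define c where "c = cnj (G \<alpha> \<delta> - G' \<alpha> \<delta>)"
  have C2: "Ck_on 2 right_half_plane (G t)" "Ck_on 2 right_half_plane (G' t)" if "t \<in> {0<..\<alpha>}" for t
    using G G' that by (auto simp: TTbar_flow_def)
  from G \<alpha> obtain C a where Ca: "\<And>t z. t \<in> {0..\<alpha>} \<Longrightarrow> z \<in> right_half_plane \<Longrightarrow>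
      norm (G t z) \<le> C * exp (a * (hyp_dist z 1)\<^sup>2)"
    unfolding TTbar_flow_def hyp_tychonoff_class_def by meson
  from G' \<alpha> obtain C' a' where Ca': "\<And>t z. t \<in> {0..\<alpha>} \<Longrightarrow> z \<in> right_half_plane \<Longrightarrow>
      norm (G' t z) \<le> C' * exp (a' * (hyp_dist z 1)\<^sup>2)"
    unfolding TTbar_flow_def hyp_tychonoff_class_def by meson
  \<comment> \<open>The maximum with 0 makes the exponent nonnegative, so that replacing the
    distance by the larger \<open>1 + ln cosh dist\<close> weakens the bound.\<close>
  define b where "b = max 0 (max a a')"
  have mono: "D * exp (e * (hyp_dist z 1)\<^sup>2) \<le> \<bar>D\<bar> * exp (b * (1 + ln (cosh_dist z))\<^sup>2)"
    if "e \<le> b" "z \<in> right_half_plane" for D e z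
  proof -
    have "0 \<le> hyp_dist z 1" "hyp_dist z 1 \<le> 1 + ln (cosh_dist z)"
      using hyp_dist_one_le[of z] that by (auto simp: right_half_plane_def)
    then have "(hyp_dist z 1)\<^sup>2 \<le> (1 + ln (cosh_dist z))\<^sup>2" by (intro power_mono)
    then have "b * (hyp_dist z 1)\<^sup>2 \<le> b * (1 + ln (cosh_dist z))\<^sup>2"
      by (intro mult_left_mono) (auto simp: b_def)
    moreover have "e * (hyp_dist z 1)\<^sup>2 \<le> b * (hyp_dist z 1)\<^sup>2"
      using that by (intro mult_right_mono) auto
    ultimately show ?thesis by (intro mult_mono) auto
  qed
  interpret heat_solution "\<lambda>t z. Re (c * (G t z - G' t z))"
    "\<lambda>t z. Re (c * (partial1 (G t) z - partial1 (G' t) z))"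
    "\<lambda>t z. Re (c * (partial2 (G t) z - partial2 (G' t) z))"
    "\<lambda>t z. Re (c * (partial1 (partial1 (G t)) z - partial1 (partial1 (G' t)) z))"
    "\<lambda>t z. Re (c * (partial2 (partial2 (G t)) z - partial2 (partial2 (G' t)) z))"
    \<alpha> b "norm c * (\<bar>C\<bar> + \<bar>C'\<bar>)"
  proof
    have "continuous_on ({0..\<alpha>} \<times> right_half_plane) (\<lambda>(t, z). G t z)"
      "continuous_on ({0..\<alpha>} \<times> right_half_plane) (\<lambda>(t, z). G' t z)"
      using G G' unfolding TTbar_flow_def by (auto elim!: continuous_on_subset)
    then show "continuous_on ({0..\<alpha>} \<times> right_half_plane) (\<lambda>(t, z). Re (c * (G t z - G' t z)))"
      unfolding case_prod_beta by (intro continuous_intros)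
  next
    fix t z assume t: "t \<in> {0<..\<alpha>}" and z: "z \<in> right_half_plane"
    have "((\<lambda>s. G s z) has_vector_derivative (- (1 / 4) * hyp_laplacian (G t) z)) (at t)"
      "((\<lambda>s. G' s z) has_vector_derivative (- (1 / 4) * hyp_laplacian (G' t) z)) (at t)"
      using G G' t z unfolding TTbar_flow_def by auto
    from Re_cmult_vector_derivative[OF this, of c]
    show "((\<lambda>r. Re (c * (G r z - G' r z))) has_real_derivative
        (Re z)\<^sup>2 / 4 * (Re (c * (partial1 (partial1 (G t)) z - partial1 (partial1 (G' t)) z)) +
          Re (c * (partial2 (partial2 (G t)) z - partial2 (partial2 (G' t)) z)))) (at t)"
      by (rule DERIV_cong) (simp add: hyp_laplacian_def algebra_simps diff_divide_distrib add_divide_distrib)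
    note d = C2[OF t, THEN Ck_on_2D(1), OF z] C2[OF t, THEN Ck_on_2D(2), OF z] C2[OF t, THEN Ck_on_2D(3), OF z]
    note line = d[THEN has_vector_derivative_along_line]
    show "((\<lambda>r. Re (c * (G t (z + of_real r) - G' t (z + of_real r)))) has_real_derivative
        Re (c * (partial1 (G t) z - partial1 (G' t) z))) (at 0)"
      using Re_cmult_vector_derivative[OF line(1,2)[of 1], of c] by (simp add: partial1_def)
    show "((\<lambda>r. Re (c * (partial1 (G t) (z + of_real r) - partial1 (G' t) (z + of_real r)))) has_real_derivative
        Re (c * (partial1 (partial1 (G t)) z - partial1 (partial1 (G' t)) z))) (at 0)"
      using Re_cmult_vector_derivative[OF line(3,4)[of 1], of c] by (simp add: partial1_def[of _ z])
    show "((\<lambda>r. Re (c * (G t (z + of_real r * \<i>) - G' t (z + of_real r * \<i>)))) has_real_derivative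
        Re (c * (partial2 (G t) z - partial2 (G' t) z))) (at 0)"
      using Re_cmult_vector_derivative[OF line(1,2)[of \<i>], of c] by (simp add: partial2_def)
    show "((\<lambda>r. Re (c * (partial2 (G t) (z + of_real r * \<i>) - partial2 (G' t) (z + of_real r * \<i>)))) has_real_derivative
        Re (c * (partial2 (partial2 (G t)) z - partial2 (partial2 (G' t)) z))) (at 0)"
      using Re_cmult_vector_derivative[OF line(5,6)[of \<i>], of c] by (simp add: partial2_def[of _ z])
  next
    fix t z assume tz: "t \<in> {0..\<alpha>}" "z \<in> right_half_plane"
    have "a \<le> b" "a' \<le> b" by (simp_all add: b_def)
    then have le: "norm (G t z - G' t z) \<le> (\<bar>C\<bar> + \<bar>C'\<bar>) * exp (b * (1 + ln (cosh_dist z))\<^sup>2)"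
      using Ca[OF tz] Ca'[OF tz] mono[OF _ tz(2), of a C] mono[OF _ tz(2), of a' C']
        norm_triangle_ineq4[of "G t z" "G' t z"] by (simp add: distrib_right)
    have "Re (c * (G t z - G' t z)) \<le> norm c * norm (G t z - G' t z)"
      by (metis complex_Re_le_cmod norm_mult)
    also have "\<dots> \<le> norm c * ((\<bar>C\<bar> + \<bar>C'\<bar>) * exp (b * (1 + ln (cosh_dist z))\<^sup>2))"
      using le by (intro mult_left_mono) auto
    finally show "Re (c * (G t z - G' t z)) \<le> norm c * (\<bar>C\<bar> + \<bar>C'\<bar>) * exp (b * (1 + ln (cosh_dist z))\<^sup>2)"
      by (simp add: mult_ac)
  qed (simp add: b_def)
  have "Re (c * (G \<alpha> \<delta> - G' \<alpha> \<delta>)) \<le> 0"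
    by (rule max_principle) (use G G' \<alpha> \<delta> in \<open>auto simp: TTbar_flow_def\<close>)
  moreover have "Re (c * (G \<alpha> \<delta> - G' \<alpha> \<delta>)) = (norm (G \<alpha> \<delta> - G' \<alpha> \<delta>))\<^sup>2"
    unfolding c_def cmod_power2 by (simp add: power2_eq_square algebra_simps)
  ultimately have "(norm (G \<alpha> \<delta> - G' \<alpha> \<delta>))\<^sup>2 \<le> 0" by linarith
  then show ?thesis by simp
qed

section \<open>Reduction to a fundamental domain\<close>

text \<open>Only finitely many lattice vectors have norm at most 1, since the imaginary part bounds
  \<open>c\<close> and then \<open>d\<close> is bounded. The vector (0, 1) is among them, so a
  minimum over this finite set is global.\<close>

lemma ex_minimal_lattice_vector:
  fixes \<tau> :: complex
  assumes "Im \<tau> > 0"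
  obtains c d :: int where "(c, d) \<noteq> (0, 0)"
    and "\<And>c' d' :: int. (c', d') \<noteq> (0, 0) \<Longrightarrow>
      norm (of_int c * \<tau> + of_int d) \<le> norm (of_int c' * \<tau> + of_int d')"
proof -
  define N where "N = (\<lambda>(c :: int, d :: int). norm (of_int c * \<tau> + of_int d))"
  define M where "M = {p. p \<noteq> (0, 0) \<and> N p \<le> 1}"
  define m where "m = \<lceil>1 / Im \<tau>\<rceil>"
  define n where "n = \<lceil>1 + norm \<tau> / Im \<tau>\<rceil>"
  have "M \<subseteq> {-m..m} \<times> {-n..n}"
  proof safe
    fix c d assume "(c, d) \<in> M"
    then have le: "norm (of_int c * \<tau> + of_int d) \<le> 1" by (simp add: M_def N_def)
    have "\<bar>of_int c * Im \<tau>\<bar> \<le> norm (of_int c * \<tau> + of_int d)"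
      using abs_Im_le_cmod[of "of_int c * \<tau> + of_int d"] by simp
    with le have c: "\<bar>of_int c\<bar> \<le> 1 / Im \<tau>" using assms by (simp add: abs_mult field_simps)
    have "\<bar>real_of_int d\<bar> = norm ((of_int c * \<tau> + of_int d) - of_int c * \<tau>)"
      by simp
    also have "\<dots> \<le> norm (of_int c * \<tau> + of_int d) + \<bar>of_int c\<bar> * norm \<tau>"
      by (metis norm_mult norm_of_int norm_triangle_ineq4)
    also have "\<dots> \<le> 1 + 1 / Im \<tau> * norm \<tau>"
      using le c by (intro add_mono mult_right_mono) auto
    finally have d: "\<bar>real_of_int d\<bar> \<le> 1 + norm \<tau> / Im \<tau>" by simp
    have "\<bar>c\<bar> \<le> m" "\<bar>d\<bar> \<le> n"
      using c d unfolding m_def n_def by linarith+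
    then show "c \<in> {-m..m}" "d \<in> {-n..n}" by auto
  qed
  then have "finite M" by (rule finite_subset) simp
  moreover have "(0, 1) \<in> M" by (simp add: M_def N_def)
  ultimately obtain p where p: "is_arg_min N (\<lambda>q. q \<in> M) p"
    using ex_is_arg_min_if_finite by blast
  obtain c d where cd: "p = (c, d)" by fastforce
  have "(c, d) \<noteq> (0, 0)" using p by (simp add: is_arg_min_def M_def cd)
  moreover have "N p \<le> N q" if "q \<noteq> (0, 0)" for q
  proof (cases "N q \<le> 1")
    case True
    then have "q \<in> M" using that by (simp add: M_def)
    then show ?thesis using p unfolding is_arg_min_def by (meson not_le)
  next
    case False
    then show ?thesis using p unfolding is_arg_min_def M_def mem_Collect_eq by linarith
  qed
  ultimately show thesis using that[of c d] by (auto simp: cd N_def)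
qed

text \<open>The image has real part \<open>Re z / (N c d)^2\<close>. The upper bound follows from
  \<open>N c d >= 1\<close> when \<open>c = 0\<close> and from \<open>N c d >= Re z\<close>
  otherwise. The lower bound follows because the image has norm at least 1 and imaginary part at
  most 1/2 in absolute value.\<close>

lemma modular_reduction:
  assumes z: "Re z > 0"
  obtains a b c d where "a * d - b * c = 1" "Re (modular_act a b c d z) \<ge> 1 / 2"
    "\<bar>Im (modular_act a b c d z)\<bar> \<le> 1 / 2" "Re (modular_act a b c d z) \<le> Re z + 1 / Re z"
proof -
  define N where "N c d = norm (of_int c * (\<i> * z) + of_int d)" for c d :: int
  have N2: "(N c d)\<^sup>2 = (of_int c * Re z)\<^sup>2 + (of_int d - of_int c * Im z)\<^sup>2" for c d
    by (simp add: N_def cmod_power2)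
  \<comment> \<open>A shortest vector of the lattice spanned by \<open>\<i> z\<close> and 1 is primitive, so it is the bottom row
    of a matrix in SL(2, Z); the top row is fixed by translating to \<open>|Im| \<le> 1/2\<close>.\<close>
  obtain c d where nz: "(c, d) \<noteq> (0, 0)" and min: "\<And>c' d'. (c', d') \<noteq> (0, 0) \<Longrightarrow> N c d \<le> N c' d'"
    using ex_minimal_lattice_vector[of "\<i> * z"] z unfolding N_def by (metis Im_i_times)
  have Npos: "N c d > 0"
  proof -
    have "(N c d)\<^sup>2 > 0"
      unfolding N2 using nz z by (cases "c = 0") (auto simp: add_pos_nonneg)
    then show ?thesis using N_def by (simp add: zero_less_power2)
  qed
  \<comment> \<open>Dividing by a common factor would give a shorter nonzero lattice vector.\<close>
  have gcd: "gcd c d = 1"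
  proof -
    obtain c' d' where cd': "c = gcd c d * c'" "d = gcd c d * d'" by (meson dvdE gcd_dvd1 gcd_dvd2)
    have "of_int c * (\<i> * z) + of_int d = of_int (gcd c d) * (of_int c' * (\<i> * z) + of_int d')"
      by (subst cd'(1), subst cd'(2)) (simp add: algebra_simps)
    then have eq: "N c d = of_int (gcd c d) * N c' d'" unfolding N_def by (simp add: norm_mult)
    have "(c', d') \<noteq> (0, 0)" using nz cd' by auto
    then have "of_int (gcd c d) * N c' d' \<le> 1 * N c' d'" using min eq by simp
    moreover have "N c' d' > 0" using eq Npos by (simp add: N_def zero_less_mult_iff)
    ultimately have "gcd c d \<le> 1" by (simp only: mult_le_cancel_right) auto
    moreover have "gcd c d > 0" using nz by (simp add: gcd_pos_int)
    ultimately show ?thesis by linarith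
  qed
  obtain e f where ef: "e * c + f * d = 1" using bezout_int[of c d] gcd by auto
  define B where "B = of_int c * (\<i> * z) + of_int d"
  have B: "B \<noteq> 0" using Npos by (auto simp: B_def N_def)
  \<comment> \<open>Adding \<open>n\<close> times the bottom row to the top row keeps the
    determinant and translates the image by \<open>- \<i> * n\<close>.\<close>
  define n where "n = round (Im (modular_act f (- e) c d z))"
  define a where "a = f + n * c"
  define b where "b = - e + n * d"
  define w where "w = modular_act a b c d z"
  have det: "a * d - b * c = 1" using ef by (simp add: a_def b_def algebra_simps)
  have "w = modular_act f (- e) c d z - \<i> * of_int n"
  proof -
    have "of_int a * (\<i> * z) + of_int b = (of_int f * (\<i> * z) + of_int (- e)) + of_int n * B"
      by (simp add: a_def b_def B_def algebra_simps)
    then have "(of_int a * (\<i> * z) + of_int b) / B =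
        (of_int f * (\<i> * z) + of_int (- e)) / B + of_int n"
      using B by (simp add: add_divide_distrib)
    then show ?thesis unfolding w_def modular_act_def B_def[symmetric]
      by (simp only: distrib_left) simp
  qed
  then have Im: "\<bar>Im w\<bar> \<le> 1 / 2"
    using of_int_round_abs_le[of "Im (modular_act f (- e) c d z)"] by (simp add: n_def abs_minus_commute)
  \<comment> \<open>The top row also gives a nonzero lattice vector, so minimality of the bottom row
    makes the quotient of their norms, \<open>norm w\<close>, at least 1.\<close>
  have "(a, b) \<noteq> (0, 0)" using det by auto
  then have "N c d \<le> N a b" by (rule min)
  moreover have "norm w = N a b / N c d"
    by (simp add: w_def modular_act_def N_def norm_mult norm_divide)
  ultimately have "norm w \<ge> 1" using Npos by simp
  have Re: "Re w = Re z / (N c d)\<^sup>2"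
  proof -
    have "Re w = Re z * of_int (a * d - b * c) / (N c d)\<^sup>2"
    proof -
      have Re: "Re (- \<i> * q) = Im q" for q by simp
      show ?thesis unfolding N2 w_def modular_act_def Re Im_divide
        by (simp add: algebra_simps)
    qed
    then show ?thesis by (simp add: det)
  qed
  have "1 \<le> (Re w)\<^sup>2 + (Im w)\<^sup>2"
    using \<open>norm w \<ge> 1\<close> by (metis cmod_power2 one_le_power)
  moreover have "(Im w)\<^sup>2 \<le> (1 / 2)\<^sup>2" using Im by (metis abs_ge_zero power2_abs power_mono)
  ultimately have "(1 / 2)\<^sup>2 \<le> (Re w)\<^sup>2" by (simp add: power2_eq_square)
  moreover have "Re w \<ge> 0" using Re z by simp
  ultimately have "Re w \<ge> 1 / 2" by (rule power2_le_imp_le)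
  moreover have "Re w \<le> Re z + 1 / Re z"
  proof (cases "c = 0")
    case True
    then have "d\<^sup>2 \<ge> 1" using nz by (simp add: int_one_le_iff_zero_less)
    then have "(N c d)\<^sup>2 \<ge> 1" unfolding N2 using True by (simp flip: of_int_power)
    then have "Re w \<le> Re z" unfolding Re using z by (simp add: divide_le_eq)
    then show ?thesis using z by (smt (verit) divide_pos_pos)
  next
    case False
    then have "c\<^sup>2 \<ge> 1" by (simp add: int_one_le_iff_zero_less)
    then have "(Re z)\<^sup>2 \<le> (of_int c)\<^sup>2 * (Re z)\<^sup>2"
      using mult_right_mono[of 1 "(of_int c)\<^sup>2" "(Re z)\<^sup>2"] by (simp flip: of_int_power)
    also have "\<dots> \<le> (N c d)\<^sup>2" unfolding N2 by (simp add: power_mult_distrib)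
    finally have "Re w \<le> Re z / (Re z)\<^sup>2" unfolding Re using z
      by (intro divide_left_mono) (auto intro!: mult_pos_pos simp: Npos)
    then show ?thesis using z by (simp add: power2_eq_square)
  qed
  ultimately show thesis using that[OF det] Im by (simp add: w_def)
qed

section \<open>Growth of Maass forms and existence of the flow\<close>

lemma maass_form_growth:
  assumes "maass_form F"
  obtains C a where "\<And>z. z \<in> right_half_plane \<Longrightarrow> norm (F z) \<le> C * exp (a * (hyp_dist z 1)\<^sup>2)"
proof -
  from assms obtain C Y and N :: nat where CYN: "\<And>z. z \<in> right_half_plane \<Longrightarrow> Re z \<ge> Y \<Longrightarrow>
      norm (F z) \<le> C * Re z ^ N"
    unfolding maass_form_def poly_bounded_at_cusp_def by blast
  define K where "K = cbox (Complex (1 / 2) (- 1 / 2)) (Complex Y (1 / 2))"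
  have "K \<subseteq> right_half_plane"
    by (auto simp: K_def right_half_plane_def in_cbox_complex_iff)
  moreover have "continuous_on right_half_plane F"
    using assms unfolding maass_form_def smooth_fun_on_def by (metis Ck_on.simps(1))
  ultimately have "compact (F ` K)"
    unfolding K_def by (intro compact_continuous_image) (auto elim: continuous_on_subset)
  then obtain B where B: "\<And>w. w \<in> K \<Longrightarrow> norm (F w) \<le> B"
    by (meson bounded_iff compact_imp_bounded imageI)
  \<comment> \<open>The absolute values cover a negative \<open>C\<close>, and also an arbitrary
    \<open>B\<close> when \<open>Y < 1 / 2\<close> makes \<open>K\<close> empty.\<close>
  define D where "D = \<bar>B\<bar> + \<bar>C\<bar>"
  \<comment> \<open>The base \<open>1 + Re w\<close> is at least 1, so one expression bounds
    \<open>F\<close> both on the compact rectangle and near the cusp.\<close>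
  have fund: "norm (F w) \<le> D * (1 + Re w) ^ N" if "Re w \<ge> 1 / 2" "\<bar>Im w\<bar> \<le> 1 / 2" for w
  proof (cases "Re w \<ge> Y")
    case True
    have "norm (F w) \<le> C * Re w ^ N"
      using CYN[of w] that True by (simp add: right_half_plane_def)
    also have "\<dots> \<le> D * (1 + Re w) ^ N"
      using that by (intro mult_mono power_mono) (auto simp: D_def)
    finally show ?thesis .
  next
    case False
    then have "norm (F w) \<le> B" using that by (intro B) (auto simp: K_def in_cbox_complex_iff)
    also have "\<dots> \<le> D * 1" by (simp add: D_def)
    also have "\<dots> \<le> D * (1 + Re w) ^ N"
      using that by (intro mult_left_mono one_le_power) (auto simp: D_def)
    finally show ?thesis .
  qed
  have "norm (F z) \<le> D * 3 ^ N * exp (real N) * exp (real N * (hyp_dist z 1)\<^sup>2)"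
    if "z \<in> right_half_plane" for z
  proof -
    have z: "Re z > 0" using that by (simp add: right_half_plane_def)
    define d where "d = hyp_dist z 1"
    define p where "p = cosh_dist z"
    have p: "p \<ge> 1" using cosh_dist_ge_1[OF z] by (simp add: p_def)
    have "cosh d = p" using z p by (simp add: d_def p_def hyp_dist_one cosh_arcosh_real)
    moreover have d0: "d \<ge> 0" using hyp_dist_one_le[OF z] by (simp add: d_def)
    then have "sinh d \<ge> 0" by simp
    ultimately have pd: "p \<le> exp d" using cosh_plus_sinh[of d] by linarith
    obtain a b c e where abce: "a * e - b * c = 1" "Re (modular_act a b c e z) \<ge> 1 / 2"
      "\<bar>Im (modular_act a b c e z)\<bar> \<le> 1 / 2" "Re (modular_act a b c e z) \<le> Re z + 1 / Re z"
      by (rule modular_reduction[OF z])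
    define w where "w = modular_act a b c e z"
    note w = abce[folded w_def]
    have "Re z + 1 / Re z \<le> 2 * p"
    proof -
      have "Re z + 1 / Re z = ((Re z)\<^sup>2 + 1) / Re z"
        using z by (simp add: add_divide_distrib power2_eq_square)
      also have "\<dots> \<le> ((Re z)\<^sup>2 + (Im z)\<^sup>2 + 1) / Re z"
        using z by (intro divide_right_mono) auto
      also have "\<dots> = 2 * p" using z by (simp add: p_def cosh_dist_def field_simps)
      finally show ?thesis .
    qed
    then have "1 + Re w \<le> 3 * exp d" using w p pd by linarith
    have "F z = F w" using assms that abce(1)
      by (simp add: maass_form_def modular_invariant_def w_def)
    then have "norm (F z) \<le> D * (1 + Re w) ^ N" using fund w by simp
    also have "\<dots> \<le> D * (3 * exp d) ^ N"
      using \<open>1 + Re w \<le> 3 * exp d\<close> w by (intro mult_left_mono power_mono) (auto simp: D_def)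
    also have "\<dots> = D * 3 ^ N * exp (real N * d)"
      by (simp add: power_mult_distrib exp_of_nat_mult)
    \<comment> \<open>Growth exponential in \<open>d\<close> is fitted to the squared distance by
      \<open>d <= 1 + d^2\<close>, at the cost of the factor \<open>exp (real N)\<close>.\<close>
    also have "\<dots> \<le> D * 3 ^ N * exp (real N * (1 + d\<^sup>2))"
    proof -
      have "(d - 1)\<^sup>2 \<ge> 0" by simp
      then have "d \<le> 1 + d\<^sup>2" using d0 by (simp add: power2_eq_square algebra_simps)
      then show ?thesis by (intro mult_left_mono) (auto simp: D_def intro!: mult_left_mono)
    qed
    finally show ?thesis by (simp add: exp_add distrib_left d_def mult_ac)
  qed
  then show thesis by (rule that)
qed

lemma maass_form_TTbar_flow:
  assumes F: "maass_form F"
    and l: "\<And>z. z \<in> right_half_plane \<Longrightarrow> hyp_laplacian F z = l * F z"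
  shows "TTbar_flow F (\<lambda>\<alpha> z. exp (of_real \<alpha> * (- (l / 4))) * F z)"
  unfolding TTbar_flow_def
proof (intro conjI ballI allI impI)
  have Ck: "Ck_on k right_half_plane F" for k
    using F by (simp add: maass_form_def smooth_fun_on_def)
  then have C2: "Ck_on 2 right_half_plane F" .
  show "Ck_on 2 right_half_plane (\<lambda>z. exp (of_real \<alpha> * (- (l / 4))) * F z)" for \<alpha> :: real
    by (rule Ck_on_cmult[OF open_right_half_plane C2])
  have "continuous_on right_half_plane F" using Ck[of 0] by simp
  then have "continuous_on ({0::real..} \<times> right_half_plane) (\<lambda>x. F (snd x))"
    by (rule continuous_on_compose2) (auto intro: continuous_intros)
  then show "continuous_on ({0..} \<times> right_half_plane) (\<lambda>(\<alpha>, z). exp (of_real \<alpha> * (- (l / 4))) * F z)"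
    unfolding case_prod_beta by (intro continuous_intros)
  show "((\<lambda>s. exp (of_real s * (- (l / 4))) * F z) has_vector_derivative
      - (1 / 4) * hyp_laplacian (\<lambda>z. exp (of_real \<alpha> * (- (l / 4))) * F z) z) (at \<alpha>)"
    if "z \<in> right_half_plane" for \<alpha> z
  proof -
    have "((\<lambda>s. exp (s * (- (l / 4))) * F z) has_field_derivative
        - (1 / 4) * (exp (of_real \<alpha> * (- (l / 4))) * (l * F z))) (at (of_real \<alpha>))"
      by (auto intro!: derivative_eq_intros)
    from has_vector_derivative_real_field[OF this] show ?thesis
      by (simp add: hyp_laplacian_cmult[OF C2 that] l[OF that])
  qed
  obtain C a where Ca: "\<And>z. z \<in> right_half_plane \<Longrightarrow> norm (F z) \<le> C * exp (a * (hyp_dist z 1)\<^sup>2)"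
    using maass_form_growth[OF F] by blast
  show "hyp_tychonoff_class (\<lambda>\<alpha> z. exp (of_real \<alpha> * (- (l / 4))) * F z)"
    unfolding hyp_tychonoff_class_def
  proof (intro allI impI exI ballI)
    fix A \<alpha> :: real and z assume "A \<ge> 0" "\<alpha> \<in> {0..A}" and z: "z \<in> right_half_plane"
    \<comment> \<open>The eigenvalue is an arbitrary complex number, so the time factor may grow; a
      bound on [0, \<open>A\<close>] suffices, and the exponent \<open>a\<close> is
      unchanged.\<close>
    have "norm (exp (of_real \<alpha> * (- (l / 4)))) \<le> exp (norm (of_real \<alpha> * (- (l / 4))))"
      by (rule norm_exp)
    also have "\<dots> \<le> exp (A * norm l)"
    proof -
      have "\<alpha> * norm l \<le> A * norm l" "0 \<le> \<alpha> * norm l" using \<open>\<alpha> \<in> {0..A}\<close> by (auto intro: mult_right_mono)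
      then have "\<alpha> * norm l \<le> A * norm l * 4" by linarith
      then show ?thesis using \<open>\<alpha> \<in> {0..A}\<close> by (simp add: norm_mult norm_divide)
    qed
    finally have "norm (exp (of_real \<alpha> * (- (l / 4))) * F z) \<le>
        exp (A * norm l) * (C * exp (a * (hyp_dist z 1)\<^sup>2))"
      unfolding norm_mult using Ca[OF z] by (intro mult_mono) auto
    then show "norm (exp (of_real \<alpha> * (- (l / 4))) * F z) \<le>
        (exp (A * norm l) * C) * exp (a * (hyp_dist z 1)\<^sup>2)"
      by (simp add: mult_ac)
  qed
qed simp

theorem theorem3:
  fixes F :: "complex \<Rightarrow> complex"
  assumes "maass_form F"
  shows "(\<exists>G. TTbar_flow F G) \<and>
    (\<forall>G. TTbar_flow F G \<longrightarrow>
      (\<forall>\<alpha>\<ge>0. \<exists>c::complex. \<forall>\<delta>\<in>right_half_plane. G \<alpha> \<delta> = c * F \<delta>))"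
proof -
  obtain l where "\<And>z. z \<in> right_half_plane \<Longrightarrow> hyp_laplacian F z = l * F z"
    using assms by (auto simp: maass_form_def)
  then have flow: "TTbar_flow F (\<lambda>\<alpha> z. exp (of_real \<alpha> * (- (l / 4))) * F z)"
    by (rule maass_form_TTbar_flow[OF assms])
  show ?thesis
  proof (intro conjI allI impI)
    show "\<exists>G. TTbar_flow F G" by (rule exI, rule flow)
    fix G and \<alpha> :: real assume G: "TTbar_flow F G" and "\<alpha> \<ge> 0"
    then show "\<exists>c. \<forall>\<delta>\<in>right_half_plane. G \<alpha> \<delta> = c * F \<delta>"
      by (intro exI[of _ "exp (of_real \<alpha> * (- (l / 4)))"] ballI TTbar_flow_unique[OF G flow])
  qed
qed

end
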